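(* There is no positive integer $n$ such that $\mathcal U(n)=M(n)^\times\cup\{[0]\}$ is a real reduced hyperfield with the operations induced from $M(n)$.
   Context: For a positive integer $n$, $\mathbb Z_n=\mathbb Z/n\mathbb Z$, $\mathbb Z_n^\times$ is its group of units, and $S_n=\{u^2:u\in\mathbb Z_n^\times\}$. $M(n)$ denotes the Marshall quotient of $\mathbb Z_n$ by $S_n$: the underlying set is the quotient of $\mathbb Z_n$ by the equivalence relation $a\sim b\iff as=bt$ for some $s,t\in S_n$; the class of $a$ is written $[a]$. The operations are $[a][b]=[ab]$, $-[a]=[-a]$, and the multivalued addition $[a]+[b]=\{[c]: cr=as+bt\text{ for some }r,s,t\in S_n\}$, with zero $[0]$ and unit $[1]$. $M(n)^\times$ denotes the set of $x\in M(n)$ for which there is $y\in M(n)$ with $xy=[1]$. A (commutative) multiring is $(R,+,\cdot,-,0,1)$ with $+:R\times R\to\mathcal P(R)\setminus\{\emptyset\}$, $\cdot:R\times R\to R$, $-:R\to R$ and $0,1\in R$ such that: $(R,+,-,0)$ is a commutative multigroup, i.e. for all $a,b,c,t$: $c\in a+b$ implies $a\in c+(-b)$ and $b\in(-a)+c$; $b\in a+0$ iff $a=b$; if $x\in a+b$ and $t\in x+c$ for some $x$, then there is $y\in b+c$ with $t\in a+y$; $c\in a+b$ iff $c\in b+a$; moreover $(R,\cdot,1)$ is a commutative monoid, $a\cdot 0=0$ for all $a$, and $c\in a+b$ implies $cd\in ad+bd$. A hyperfield is a multiring with $0\neq 1$ in which every non-zero element is invertible (equivalently, for such multirings, one also has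 $(a+b)d=ad+bd$). "$\mathcal U(n)$ is a hyperfield with the operations induced from $M(n)$" means: $\mathcal U(n)$ contains $[0],[1]$, is closed under product and negation, satisfies $x+y\subseteq\mathcal U(n)$ (sum computed in $M(n)$) for all $x,y\in\mathcal U(n)$, and with the restricted operations is a hyperfield. A hyperfield $F$ is real reduced if $a^3=a$ for every $a\in F$ and, for every $a\in F$, $a\in 1+1$ implies $a=1$. *)

theory Defs
  imports "HOL-Algebra.IntRing"
begin

section \<open>Multirings and real reduced hyperfields\<close>

record 'a multiring = "'a monoid" +
  madd  :: "'a \<Rightarrow> 'a \<Rightarrow> 'a set"  (infixl "\<boxplus>\<index>" 65)
  mneg  :: "'a \<Rightarrow> 'a"          ("\<boxminus>\<index> _" [81] 80)
  mzero :: 'a                  ("\<zero>\<^sub>m\<index>")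

locale comm_multigroup =
  fixes R (structure)
  assumes madd_closed: "\<lbrakk>a \<in> carrier R; b \<in> carrier R\<rbrakk> \<Longrightarrow> a \<boxplus> b \<subseteq> carrier R"
    and madd_nonempty: "\<lbrakk>a \<in> carrier R; b \<in> carrier R\<rbrakk> \<Longrightarrow> a \<boxplus> b \<noteq> {}"
    and mneg_closed: "a \<in> carrier R \<Longrightarrow> \<boxminus> a \<in> carrier R"
    and mzero_closed: "\<zero>\<^sub>m \<in> carrier R"
    and reversible_left:
      "\<lbrakk>a \<in> carrier R; b \<in> carrier R; c \<in> carrier R; c \<in> a \<boxplus> b\<rbrakk> \<Longrightarrow> a \<in> c \<boxplus> (\<boxminus> b)"
    and reversible_right:
      "\<lbrakk>a \<in> carrier R; b \<in> carrier R; c \<in> carrier R; c \<in> a \<boxplus> b\<rbrakk> \<Longrightarrow> b \<in> (\<boxminus> a) \<boxplus> c"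
    and madd_mzero:
      "\<lbrakk>a \<in> carrier R; b \<in> carrier R\<rbrakk> \<Longrightarrow> b \<in> a \<boxplus> \<zero>\<^sub>m \<longleftrightarrow> a = b"
    and madd_assoc:
      "\<lbrakk>a \<in> carrier R; b \<in> carrier R; c \<in> carrier R; t \<in> carrier R;
        \<exists>x \<in> carrier R. x \<in> a \<boxplus> b \<and> t \<in> x \<boxplus> c\<rbrakk>
       \<Longrightarrow> \<exists>y \<in> carrier R. y \<in> b \<boxplus> c \<and> t \<in> a \<boxplus> y"
    and madd_comm:
      "\<lbrakk>a \<in> carrier R; b \<in> carrier R; c \<in> carrier R\<rbrakk> \<Longrightarrow> c \<in> a \<boxplus> b \<longleftrightarrow> c \<in> b \<boxplus> a"

locale multiring = comm_multigroup R + comm_monoid R for R (structure) +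
  assumes mult_mzero: "a \<in> carrier R \<Longrightarrow> a \<otimes> \<zero>\<^sub>m = \<zero>\<^sub>m"
    and weak_distrib:
      "\<lbrakk>a \<in> carrier R; b \<in> carrier R; c \<in> carrier R; d \<in> carrier R; c \<in> a \<boxplus> b\<rbrakk>
       \<Longrightarrow> c \<otimes> d \<in> (a \<otimes> d) \<boxplus> (b \<otimes> d)"

locale hyperfield = multiring +
  assumes mzero_not_one: "\<zero>\<^sub>m \<noteq> \<one>"
    and nonzero_invertible: "\<lbrakk>a \<in> carrier R; a \<noteq> \<zero>\<^sub>m\<rbrakk> \<Longrightarrow> a \<in> Units R"

locale real_reduced_hyperfield = hyperfield +
  assumes cube_eq: "a \<in> carrier R \<Longrightarrow> a [^] (3::nat) = a"
    and one_plus_one: "\<lbrakk>a \<in> carrier R; a \<in> \<one> \<boxplus> \<one>\<rbrakk> \<Longrightarrow> a = \<one>"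

definition induced_hyperfield :: "('a, 'm) multiring_scheme \<Rightarrow> 'a set \<Rightarrow> bool" where
  "induced_hyperfield M U \<longleftrightarrow>
     U \<subseteq> carrier M \<and> \<zero>\<^sub>m\<^bsub>M\<^esub> \<in> U \<and> \<one>\<^bsub>M\<^esub> \<in> U \<and>
     (\<forall>x\<in>U. \<forall>y\<in>U. x \<otimes>\<^bsub>M\<^esub> y \<in> U) \<and> (\<forall>x\<in>U. \<boxminus>\<^bsub>M\<^esub> x \<in> U) \<and>
     (\<forall>x\<in>U. \<forall>y\<in>U. x \<boxplus>\<^bsub>M\<^esub> y \<subseteq> U) \<and>
     hyperfield (M\<lparr>carrier := U\<rparr>)"


section \<open>Marshall quotients\<close>

definition marshall_rel :: "('a, 'b) ring_scheme \<Rightarrow> 'a set \<Rightarrow> ('a \<times> 'a) set" where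
  "marshall_rel R S =
     {(a, b). a \<in> carrier R \<and> b \<in> carrier R \<and> (\<exists>s\<in>S. \<exists>t\<in>S. a \<otimes>\<^bsub>R\<^esub> s = b \<otimes>\<^bsub>R\<^esub> t)}"

abbreviation marshall_class :: "('a, 'b) ring_scheme \<Rightarrow> 'a set \<Rightarrow> 'a \<Rightarrow> 'a set" where
  "marshall_class R S a \<equiv> marshall_rel R S `` {a}"

text \<open>
  The operations are defined on classes by ranging over all representatives.  The lemmas
  \<open>marshall_mult\<close>, \<open>marshall_neg\<close> and \<open>marshall_add\<close> below show that the choice of
  representatives is immaterial and give the usual formulas.
\<close>

definition marshall_quotient :: "('a, 'b) ring_scheme \<Rightarrow> 'a set \<Rightarrow> 'a set multiring" where
  "marshall_quotient R S =
     \<lparr>carrier = carrier R // marshall_rel R S,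
      mult = (\<lambda>X Y. \<Union>a\<in>X. \<Union>b\<in>Y. marshall_class R S (a \<otimes>\<^bsub>R\<^esub> b)),
      one = marshall_class R S \<one>\<^bsub>R\<^esub>,
      madd = (\<lambda>X Y. {marshall_class R S c | c. c \<in> carrier R \<and>
                (\<exists>a\<in>X. \<exists>b\<in>Y. \<exists>r\<in>S. \<exists>s\<in>S. \<exists>t\<in>S.
                   c \<otimes>\<^bsub>R\<^esub> r = a \<otimes>\<^bsub>R\<^esub> s \<oplus>\<^bsub>R\<^esub> b \<otimes>\<^bsub>R\<^esub> t)}),
      mneg = (\<lambda>X. \<Union>a\<in>X. marshall_class R S (\<ominus>\<^bsub>R\<^esub> a)),
      mzero = marshall_class R S \<zero>\<^bsub>R\<^esub>\<rparr>"

context cring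
begin

context
  fixes S
  assumes S_carrier: "S \<subseteq> carrier R" and S_one: "\<one> \<in> S"
    and S_mult: "\<And>s t. s \<in> S \<Longrightarrow> t \<in> S \<Longrightarrow> s \<otimes> t \<in> S"
begin

lemma equiv_marshall_rel: "equiv (carrier R) (marshall_rel R S)"
proof (rule equivI)
  show "marshall_rel R S \<subseteq> carrier R \<times> carrier R" by (auto simp: marshall_rel_def)
  show "refl_on (carrier R) (marshall_rel R S)"
    using S_one by (auto simp: marshall_rel_def refl_on_def)
  show "sym (marshall_rel R S)"
    unfolding marshall_rel_def sym_def by (blast intro: sym)
  show "trans (marshall_rel R S)"
  proof (rule transI)
    fix a b c assume "(a, b) \<in> marshall_rel R S" "(b, c) \<in> marshall_rel R S"
    then obtain s t u v where *: "a \<in> carrier R" "b \<in> carrier R" "c \<in> carrier R"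
      "s \<in> S" "t \<in> S" "u \<in> S" "v \<in> S" "a \<otimes> s = b \<otimes> t" "b \<otimes> u = c \<otimes> v"
      by (auto simp: marshall_rel_def)
    then have c: "s \<in> carrier R" "t \<in> carrier R" "u \<in> carrier R" "v \<in> carrier R"
      using S_carrier by auto
    have "a \<otimes> (s \<otimes> u) = (a \<otimes> s) \<otimes> u" using *(1) c by (simp only: m_assoc)
    also have "\<dots> = (b \<otimes> u) \<otimes> t" unfolding *(8) using *(2) c by (simp add: m_ac)
    also have "\<dots> = c \<otimes> (v \<otimes> t)" unfolding *(9) using *(3) c by (simp only: m_assoc)
    finally show "(a, c) \<in> marshall_rel R S"
      using * S_mult unfolding marshall_rel_def by blast
  qed
qed

lemma marshall_mult:
  assumes "a \<in> carrier R" "b \<in> carrier R"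
  shows "marshall_class R S a \<otimes>\<^bsub>marshall_quotient R S\<^esub> marshall_class R S b
       = marshall_class R S (a \<otimes> b)"
proof -
  have "(\<lambda>a b. marshall_class R S (a \<otimes> b)) respects2 marshall_rel R S"
  proof (rule congruent2I[OF equiv_marshall_rel equiv_marshall_rel]; rule equiv_class_eq[OF equiv_marshall_rel])
    have *: "(a \<otimes> c, b \<otimes> c) \<in> marshall_rel R S"
      if "(a, b) \<in> marshall_rel R S" "c \<in> carrier R" for a b c
    proof -
      from that obtain s t where st: "a \<in> carrier R" "b \<in> carrier R" "s \<in> S" "t \<in> S" "a \<otimes> s = b \<otimes> t"
        by (auto simp: marshall_rel_def)
      then have "s \<in> carrier R" "t \<in> carrier R" using S_carrier by auto
      then have "(a \<otimes> c) \<otimes> s = (b \<otimes> c) \<otimes> t"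
        using st that by (metis m_assoc m_comm)
      with st that show ?thesis by (auto simp: marshall_rel_def)
    qed
    then show "(a \<otimes> c, b \<otimes> c) \<in> marshall_rel R S"
      if "(a, b) \<in> marshall_rel R S" "c \<in> carrier R" for a b c using that .
    show "(c \<otimes> a, c \<otimes> b) \<in> marshall_rel R S"
      if "(a, b) \<in> marshall_rel R S" "c \<in> carrier R" for a b c
    proof -
      have "a \<in> carrier R" "b \<in> carrier R" using that by (auto simp: marshall_rel_def)
      then show ?thesis using *[OF that] that by (simp add: m_comm)
    qed
  qed
  then show ?thesis
    using UN_equiv_class2[OF equiv_marshall_rel equiv_marshall_rel _ assms]
    by (simp add: marshall_quotient_def)
qed

lemma marshall_neg:
  assumes "a \<in> carrier R"
  shows "\<boxminus>\<^bsub>marshall_quotient R S\<^esub> marshall_class R S a = marshall_class R S (\<ominus> a)"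
proof -
  have "(\<lambda>a. marshall_class R S (\<ominus> a)) respects marshall_rel R S"
  proof (rule congruentI, rule equiv_class_eq[OF equiv_marshall_rel])
    fix a b assume "(a, b) \<in> marshall_rel R S"
    then obtain s t where st: "a \<in> carrier R" "b \<in> carrier R" "s \<in> S" "t \<in> S" "a \<otimes> s = b \<otimes> t"
      by (auto simp: marshall_rel_def)
    then have "(\<ominus> a) \<otimes> s = (\<ominus> b) \<otimes> t" using S_carrier by (auto simp: l_minus subset_iff)
    then show "(\<ominus> a, \<ominus> b) \<in> marshall_rel R S" using st by (auto simp: marshall_rel_def)
  qed
  then show ?thesis
    using UN_equiv_class[OF equiv_marshall_rel _ assms] by (simp add: marshall_quotient_def)
qed

lemma marshall_add:
  assumes ab: "a \<in> carrier R" "b \<in> carrier R"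
  shows "marshall_class R S a \<boxplus>\<^bsub>marshall_quotient R S\<^esub> marshall_class R S b
       = {marshall_class R S c | c. c \<in> carrier R \<and>
            (\<exists>r\<in>S. \<exists>s\<in>S. \<exists>t\<in>S. c \<otimes> r = a \<otimes> s \<oplus> b \<otimes> t)}" (is "?L = ?R")
proof
  have "a \<in> marshall_class R S a" "b \<in> marshall_class R S b"
    using ab equiv_class_self[OF equiv_marshall_rel] by blast+
  then show "?R \<subseteq> ?L" unfolding marshall_quotient_def by auto blast
next
  show "?L \<subseteq> ?R"
  proof
    fix X assume "X \<in> ?L"
    then obtain c a' b' r s t where X: "X = marshall_class R S c" "c \<in> carrier R"
      "(a, a') \<in> marshall_rel R S" "(b, b') \<in> marshall_rel R S"
      and S: "r \<in> S" "s \<in> S" "t \<in> S" and eq: "c \<otimes> r = a' \<otimes> s \<oplus> b' \<otimes> t"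
      by (auto simp: marshall_quotient_def)
    then obtain u v w z where uv: "u \<in> S" "v \<in> S" "a \<otimes> u = a' \<otimes> v"
      and wz: "w \<in> S" "z \<in> S" "b \<otimes> w = b' \<otimes> z"
      and c': "a' \<in> carrier R" "b' \<in> carrier R"
      by (auto simp: marshall_rel_def)
    note c = c' ab X(2) subsetD[OF S_carrier S(1)] subsetD[OF S_carrier S(2)]
      subsetD[OF S_carrier S(3)] subsetD[OF S_carrier uv(1)] subsetD[OF S_carrier uv(2)]
      subsetD[OF S_carrier wz(1)] subsetD[OF S_carrier wz(2)]
    have "c \<otimes> (r \<otimes> (v \<otimes> z)) = (c \<otimes> r) \<otimes> (v \<otimes> z)" using c by (simp add: m_assoc)
    also have "\<dots> = (a' \<otimes> v) \<otimes> (s \<otimes> z) \<oplus> (b' \<otimes> z) \<otimes> (t \<otimes> v)"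
      using c by (simp add: eq l_distr r_distr m_ac)
    also have "\<dots> = (a \<otimes> u) \<otimes> (s \<otimes> z) \<oplus> (b \<otimes> w) \<otimes> (t \<otimes> v)" using uv wz by simp
    also have "\<dots> = a \<otimes> (u \<otimes> (s \<otimes> z)) \<oplus> b \<otimes> (w \<otimes> (t \<otimes> v))" using c by (simp add: m_assoc)
    finally have "c \<otimes> (r \<otimes> (v \<otimes> z)) = \<dots>" .
    moreover have "r \<otimes> (v \<otimes> z) \<in> S" "u \<otimes> (s \<otimes> z) \<in> S" "w \<otimes> (t \<otimes> v) \<in> S"
      using S uv wz S_mult by auto
    ultimately show "X \<in> ?R" using X(1,2) by blast
  qed
qed

end

end


section \<open>The quotient of the integers modulo n by the squares of units\<close>

text \<open>The ring of integers modulo \<open>n\<close> is \<open>ZFact (int n)\<close>, the quotient of the ring of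
  integers by the ideal generated by \<open>n\<close>.\<close>

definition unit_squares :: "nat \<Rightarrow> int set set" where
  "unit_squares n = {u [^]\<^bsub>ZFact (int n)\<^esub> (2::nat) | u. u \<in> Units (ZFact (int n))}"

definition marshall_Z :: "nat \<Rightarrow> int set set multiring" where
  "marshall_Z n = marshall_quotient (ZFact (int n)) (unit_squares n)"

lemma unit_squares_submonoid:
  "unit_squares n \<subseteq> carrier (ZFact (int n))"
  "\<one>\<^bsub>ZFact (int n)\<^esub> \<in> unit_squares n"
  "\<lbrakk>s \<in> unit_squares n; t \<in> unit_squares n\<rbrakk> \<Longrightarrow> s \<otimes>\<^bsub>ZFact (int n)\<^esub> t \<in> unit_squares n"
proof -
  interpret cring "ZFact (int n)" by (rule ZFact_is_cring)
  show "unit_squares n \<subseteq> carrier (ZFact (int n))" by (auto simp: unit_squares_def)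
  show "\<one>\<^bsub>ZFact (int n)\<^esub> \<in> unit_squares n"
    unfolding unit_squares_def using Units_one_closed by force
  assume "s \<in> unit_squares n" "t \<in> unit_squares n"
  then obtain u v where "u \<in> Units (ZFact (int n))" "v \<in> Units (ZFact (int n))"
    "s = u [^]\<^bsub>ZFact (int n)\<^esub> (2::nat)" "t = v [^]\<^bsub>ZFact (int n)\<^esub> (2::nat)"
    by (auto simp: unit_squares_def)
  then show "s \<otimes>\<^bsub>ZFact (int n)\<^esub> t \<in> unit_squares n"
    unfolding unit_squares_def
    by (auto intro!: exI[of _ "u \<otimes>\<^bsub>ZFact (int n)\<^esub> v"] simp: nat_pow_distrib Units_closed)
qed

definition units_zero :: "nat \<Rightarrow> int set set set" where
  "units_zero n = Units (marshall_Z n) \<union> {\<zero>\<^sub>m\<^bsub>marshall_Z n\<^esub>}"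

end

theory Submission
  imports Defs
begin

text \<open>
  The condition on \<open>1 + 1\<close> in a real reduced hyperfield is an ordering condition, and it is
  incompatible with positive characteristic.  Write \<open>[k]\<close> for the class of \<open>k\<close> times the unit.
  If \<open>[1] + [1]\<close> has no element besides \<open>[1]\<close>, then every positive multiple of the unit lies in
  the class \<open>[1]\<close>: from \<open>[k] = [1]\<close> it follows that \<open>[k + 1] \<in> [k] + [1] = [1] + [1]\<close>.  In the
  integers modulo \<open>n\<close> the multiple \<open>k = n\<close> is zero, so \<open>[0] = [1]\<close>, which no hyperfield permits.
\<close>

text \<open>Taking all multipliers in the multivalued addition to be \<open>\<one>\<close> is enough here.  This is the
  only source of elements of a sum of classes in the induction on multiples of the unit.\<close>

lemma (in cring) marshall_class_add_mem:
  assumes S: "S \<subseteq> carrier R" "\<one> \<in> S" "\<And>s t. s \<in> S \<Longrightarrow> t \<in> S \<Longrightarrow> s \<otimes> t \<in> S"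
    and ab: "a \<in> carrier R" "b \<in> carrier R"
  shows "marshall_class R S (a \<oplus> b)
           \<in> marshall_class R S a \<boxplus>\<^bsub>marshall_quotient R S\<^esub> marshall_class R S b"
proof -
  have "(a \<oplus> b) \<otimes> \<one> = a \<otimes> \<one> \<oplus> b \<otimes> \<one>" using ab by simp
  moreover have "marshall_class R S a \<boxplus>\<^bsub>marshall_quotient R S\<^esub> marshall_class R S b
       = {marshall_class R S c | c. c \<in> carrier R \<and>
            (\<exists>r\<in>S. \<exists>s\<in>S. \<exists>t\<in>S. c \<otimes> r = a \<otimes> s \<oplus> b \<otimes> t)}"
    by (rule marshall_add) (use S ab in auto)
  ultimately show ?thesis using S(2) a_closed[OF ab] by blast
qed

lemma (in cring) marshall_class_multiple_of_one:
  assumes S: "S \<subseteq> carrier R" "\<one> \<in> S" "\<And>s t. s \<in> S \<Longrightarrow> t \<in> S \<Longrightarrow> s \<otimes> t \<in> S"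
    and one_add_one: "marshall_class R S \<one> \<boxplus>\<^bsub>marshall_quotient R S\<^esub> marshall_class R S \<one>
                        \<subseteq> {marshall_class R S \<one>}"
  shows "marshall_class R S ([Suc k] \<cdot> \<one>) = marshall_class R S \<one>"
proof (induction k)
  case 0
  show ?case by simp
next
  case (Suc k)
  have "marshall_class R S ([Suc k] \<cdot> \<one> \<oplus> \<one>)
          \<in> marshall_class R S \<one> \<boxplus>\<^bsub>marshall_quotient R S\<^esub> marshall_class R S \<one>"
    using marshall_class_add_mem[of S "[Suc k] \<cdot> \<one>" \<one>] S unfolding Suc.IH by simp
  then show ?case using one_add_one by auto
qed

text \<open>Reduction modulo \<open>n\<close> is a ring homomorphism, hence preserves multiples of the unit.\<close>

lemma ZFact_multiple_of_one:
  "[k] \<cdot>\<^bsub>ZFact (int n)\<^esub> \<one>\<^bsub>ZFact (int n)\<^esub> = Idl\<^bsub>\<Z>\<^esub> {int n} +>\<^bsub>\<Z>\<^esub> int k"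
proof -
  interpret Q: cring "ZFact (int n)" by (rule ZFact_is_cring)
  interpret I: ideal "Idl\<^bsub>\<Z>\<^esub> {int n}" \<Z> by (rule int.genideal_ideal) simp
  have hom: "(+>\<^bsub>\<Z>\<^esub>) (Idl\<^bsub>\<Z>\<^esub> {int n}) \<in> ring_hom \<Z> (ZFact (int n))"
    unfolding ZFact_def by (rule I.rcos_ring_hom)
  show ?thesis
  proof (induction k)
    case 0
    have "Idl\<^bsub>\<Z>\<^esub> {int n} +>\<^bsub>\<Z>\<^esub> 0 = \<zero>\<^bsub>ZFact (int n)\<^esub>"
      using int.a_rcos_zero[OF I.is_ideal I.zero_closed] by (simp add: ZFact_def FactRing_def)
    then show ?case by simp
  next
    case (Suc k)
    then show ?case
      using ring_hom_add[OF hom, of "int k" 1] ring_hom_one[OF hom] by (simp add: add.commute)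
  qed
qed

lemma ZFact_characteristic:
  "[n] \<cdot>\<^bsub>ZFact (int n)\<^esub> \<one>\<^bsub>ZFact (int n)\<^esub> = \<zero>\<^bsub>ZFact (int n)\<^esub>"
proof -
  have "int n \<in> Idl\<^bsub>\<Z>\<^esub> {int n}" by (rule int.genideal_self') simp
  moreover have "ideal (Idl\<^bsub>\<Z>\<^esub> {int n}) \<Z>" by (rule int.genideal_ideal) simp
  ultimately show ?thesis
    unfolding ZFact_multiple_of_one using int.a_rcos_zero
    by (simp add: ZFact_def FactRing_def)
qed

theorem corollary5p15:
  shows "\<not> (\<exists>n::nat. n > 0 \<and>
           induced_hyperfield (marshall_Z n) (units_zero n) \<and>
           real_reduced_hyperfield ((marshall_Z n)\<lparr>carrier := units_zero n\<rparr>))"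
proof
  assume "\<exists>n::nat. n > 0 \<and>
           induced_hyperfield (marshall_Z n) (units_zero n) \<and>
           real_reduced_hyperfield ((marshall_Z n)\<lparr>carrier := units_zero n\<rparr>)"
  then obtain n where "n > 0"
    and U: "real_reduced_hyperfield ((marshall_Z n)\<lparr>carrier := units_zero n\<rparr>)" by blast
  interpret U: real_reduced_hyperfield "(marshall_Z n)\<lparr>carrier := units_zero n\<rparr>" by (rule U)
  interpret Z: cring "ZFact (int n)" by (rule ZFact_is_cring)
  let ?cls = "marshall_class (ZFact (int n)) (unit_squares n)"
  have one: "\<one>\<^bsub>marshall_Z n\<^esub> = ?cls \<one>\<^bsub>ZFact (int n)\<^esub>"
    and zero: "\<zero>\<^sub>m\<^bsub>marshall_Z n\<^esub> = ?cls \<zero>\<^bsub>ZFact (int n)\<^esub>"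
    by (simp_all add: marshall_Z_def marshall_quotient_def)
  have "\<one>\<^bsub>marshall_Z n\<^esub> \<boxplus>\<^bsub>marshall_Z n\<^esub> \<one>\<^bsub>marshall_Z n\<^esub> \<subseteq> {\<one>\<^bsub>marshall_Z n\<^esub>}"
    using U.madd_closed[OF U.one_closed U.one_closed] U.one_plus_one by auto
  then have "?cls ([Suc (n - 1)] \<cdot>\<^bsub>ZFact (int n)\<^esub> \<one>\<^bsub>ZFact (int n)\<^esub>) = ?cls \<one>\<^bsub>ZFact (int n)\<^esub>"
    unfolding one unfolding marshall_Z_def
    by (intro Z.marshall_class_multiple_of_one unit_squares_submonoid)
  then have "\<zero>\<^sub>m\<^bsub>marshall_Z n\<^esub> = \<one>\<^bsub>marshall_Z n\<^esub>"
    unfolding one zero using \<open>n > 0\<close> by (simp add: ZFact_characteristic)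
  then show False using U.mzero_not_one by simp
qed

end
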